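(* Let $N\ge1$. For every $l=1,\dots,N+1$, the $C^{(2)}_{N+1}$ Ruijsenaars-Schneider Hamiltonian $\mathcal H_l$ (a function of $q_1,\dots,q_N,\theta_1,\dots,\theta_N$) equals the sum of all principal $l\times l$ minors of the $C^{(2)}_{N+1}$ Lax matrix $L$; equivalently, $\mathcal H_l=P_l\big((\mathrm{Tr}\,L^m)_{m\ge1}\big)$, where $P_l$ is the $l$-th Newton polynomial expressing the $l$-th elementary symmetric function of the eigenvalues of $L$ through the traces $\mathrm{Tr}\,L^m$.
   Context: Let $\beta,\nu,\gamma$ be nonzero parameters, $T=\frac{2i\pi}{\nu}$ (with $i$ the imaginary unit), and $$f(q)=1-\frac{\sinh^2\gamma}{\sinh^2(\nu q/2)},\qquad c(q)=\frac{\sinh\gamma}{\sinh(\frac{\nu q}{2}+\gamma)} ,$$ square roots having their cut on the negative real axis; identities between products of square roots are understood with consistent branches, e.g. for real parameters on the region where $f(q_i-q_k)>0$ for all distinct indices $i,k$ below. Index set: $\mathcal I=\{-N,\dots,-1,0,\bar 0,1,\dots,N\}$ ($2N+2$ elements). Independent variables are $q_1,\dots,q_N,\theta_1,\dots,\theta_N$, and for the other indices one sets $q_{-j}=-q_j$, $\theta_{-j}=-\theta_j$ ($1\le j\le N$), $q_0=0$, $q_{\bar 0}=T/2$, $\theta_0=\theta_{\bar0}=0$. It is assumed that $q_i\not\equiv q_k\pmod T$ for distinct $i,k\in\mathcal I$ and that all the expressions $c(q_i-q_k)$ are finite. For $I\subset\mathcal I$ put $\theta_I=\sum_{i\in I}\theta_i$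 and $f_I=\prod_{i\in I,\,k\in\mathcal I\setminus I}f(q_i-q_k)^{1/2}$. The $C^{(2)}_{N+1}$ Ruijsenaars-Schneider Hamiltonians are $$\mathcal H_l=\frac12\Big(\sum_{I\subset\mathcal I,\,|I|=l}e^{-\beta\theta_I}f_I+\sum_{I\subset\mathcal I,\,|I|=l}e^{\beta\theta_I}f_I\Big),\qquad 1\le l\le N+1,$$ that is, the restriction to this folded submanifold of the corresponding $A_{2N+1}$ Hamiltonians. The $C^{(2)}_{N+1}$ Lax matrix is the $(2N+2)\times(2N+2)$ matrix $$L=(L_{ij})_{i,j\in\mathcal I},\qquad L_{ij}=c(q_i-q_j)\,e^{-\beta\theta_j}\,f_{\{j\}} .$$ *)

theory Defs
  imports Complex_Main "Jordan_Normal_Form.Determinant" "Jordan_Normal_Form.DL_Submatrix"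
begin

section \<open>Ruijsenaars-Schneider Hamiltonians\<close>

definition rs_period :: "complex \<Rightarrow> complex" where
  "rs_period \<nu> = 2 * \<i> * of_real pi / \<nu>"

definition rs_f :: "complex \<Rightarrow> complex \<Rightarrow> complex \<Rightarrow> complex" where
  "rs_f \<nu> \<gamma> q = 1 - (sinh \<gamma>)\<^sup>2 / (sinh (\<nu> * q / 2))\<^sup>2"

definition rs_c :: "complex \<Rightarrow> complex \<Rightarrow> complex \<Rightarrow> complex" where
  "rs_c \<nu> \<gamma> q = sinh \<gamma> / sinh (\<nu> * q / 2 + \<gamma>)"

text \<open>
  The next two definitions make sense for an arbitrary finite index set \<open>J\<close> with coordinates
  \<open>x\<close> and \<open>\<theta>\<close>. For unconstrained coordinates they give the
  Hamiltonians of type \<open>A\<close>; below they are restricted to the folded submanifold.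
  Square roots are principal (cut on the negative real axis). Since \<open>rs_f\<close> is even and
  \<open>rs_period \<nu>\<close>-periodic, its values at the arguments which have to be identified are
  equal, so that the principal roots are a consistent choice of branches for all complex parameters.
\<close>

definition rs_weight ::
  "complex \<Rightarrow> complex \<Rightarrow> 'i set \<Rightarrow> ('i \<Rightarrow> complex) \<Rightarrow> 'i set \<Rightarrow> complex" where
  "rs_weight \<nu> \<gamma> J x I = (\<Prod>(i, k) \<in> I \<times> (J - I). csqrt (rs_f \<nu> \<gamma> (x i - x k)))"

definition rs_hamiltonian ::
  "complex \<Rightarrow> complex \<Rightarrow> complex \<Rightarrow> 'i set \<Rightarrow> ('i \<Rightarrow> complex) \<Rightarrow> ('i \<Rightarrow> complex) \<Rightarrow> nat \<Rightarrow> complex" where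
  "rs_hamiltonian \<beta> \<nu> \<gamma> J x \<theta> l =
     ((\<Sum>I | I \<subseteq> J \<and> card I = l. exp (- \<beta> * (\<Sum>i\<in>I. \<theta> i)) * rs_weight \<nu> \<gamma> J x I) +
      (\<Sum>I | I \<subseteq> J \<and> card I = l. exp (\<beta> * (\<Sum>i\<in>I. \<theta> i)) * rs_weight \<nu> \<gamma> J x I)) / 2"


section \<open>The folding of type $C^{(2)}_{N+1}$\<close>

datatype index = Idx int | ZeroBar

definition index_list :: "nat \<Rightarrow> index list" where
  "index_list N = map Idx [- int N..0] @ [ZeroBar] @ map Idx [1..int N]"

definition indices :: "nat \<Rightarrow> index set" where
  "indices N = insert ZeroBar (Idx ` {- int N..int N})"

text \<open>
  The independent variables are the values of \<open>q\<close> and \<open>\<theta>\<close> at \<open>1, \<dots>, N\<close>; the other values are never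
  used for indices in \<open>indices N\<close>.
\<close>

fun fold_q :: "complex \<Rightarrow> (nat \<Rightarrow> complex) \<Rightarrow> index \<Rightarrow> complex" where
  "fold_q \<nu> q (Idx k) = (if k > 0 then q (nat k) else if k < 0 then - q (nat (- k)) else 0)"
| "fold_q \<nu> q ZeroBar = rs_period \<nu> / 2"

fun fold_theta :: "(nat \<Rightarrow> complex) \<Rightarrow> index \<Rightarrow> complex" where
  "fold_theta \<theta> (Idx k) = (if k > 0 then \<theta> (nat k) else if k < 0 then - \<theta> (nat (- k)) else 0)"
| "fold_theta \<theta> ZeroBar = 0"

definition C2_hamiltonian ::
  "complex \<Rightarrow> complex \<Rightarrow> complex \<Rightarrow> nat \<Rightarrow> (nat \<Rightarrow> complex) \<Rightarrow> (nat \<Rightarrow> complex) \<Rightarrow> nat \<Rightarrow> complex" where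
  "C2_hamiltonian \<beta> \<nu> \<gamma> N q \<theta> l =
     rs_hamiltonian \<beta> \<nu> \<gamma> (indices N) (fold_q \<nu> q) (fold_theta \<theta>) l"

definition C2_lax_entry ::
  "complex \<Rightarrow> complex \<Rightarrow> complex \<Rightarrow> nat \<Rightarrow> (nat \<Rightarrow> complex) \<Rightarrow> (nat \<Rightarrow> complex) \<Rightarrow> index \<Rightarrow> index \<Rightarrow> complex" where
  "C2_lax_entry \<beta> \<nu> \<gamma> N q \<theta> i j =
     rs_c \<nu> \<gamma> (fold_q \<nu> q i - fold_q \<nu> q j) * exp (- \<beta> * fold_theta \<theta> j) *
     rs_weight \<nu> \<gamma> (indices N) (fold_q \<nu> q) {j}"

definition C2_lax ::
  "complex \<Rightarrow> complex \<Rightarrow> complex \<Rightarrow> nat \<Rightarrow> (nat \<Rightarrow> complex) \<Rightarrow> (nat \<Rightarrow> complex) \<Rightarrow> complex mat" where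
  "C2_lax \<beta> \<nu> \<gamma> N q \<theta> = mat (2 * N + 2) (2 * N + 2)
     (\<lambda>(a, b). C2_lax_entry \<beta> \<nu> \<gamma> N q \<theta> (index_list N ! a) (index_list N ! b))"

lemma set_index_list: "set (index_list N) = indices N"
proof -
  have "{- int N..int N} = {- int N..0} \<union> {1..int N}" by auto
  then show ?thesis by (simp add: index_list_def indices_def image_Un)
qed

lemma length_index_list: "length (index_list N) = 2 * N + 2"
  by (simp add: index_list_def nat_add_distrib)

lemma distinct_index_list: "distinct (index_list N)"
  by (auto simp: index_list_def distinct_map inj_on_def)


section \<open>Principal minors, traces and Newton polynomials\<close>

definition sum_principal_minors :: "nat \<Rightarrow> 'a :: comm_ring_1 mat \<Rightarrow> 'a" where
  "sum_principal_minors l A =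
     (\<Sum>S | S \<subseteq> {..<dim_row A} \<and> card S = l. det (submatrix A S S))"

definition mat_trace :: "'a :: comm_monoid_add mat \<Rightarrow> 'a" where
  "mat_trace A = (\<Sum>i<dim_row A. A $$ (i, i))"

text \<open>
  \<open>newton_poly l p\<close> is the value of the \<open>l\<close>-th Newton polynomial $P_l$ at $p_1, p_2, \dots$, given by
  $l\, P_l = \sum_{k=1}^{l} (-1)^{k-1} P_{l-k}\, p_k$ (the value \<open>p 0\<close> is not used).
\<close>

fun newton_poly :: "nat \<Rightarrow> (nat \<Rightarrow> 'a :: field_char_0) \<Rightarrow> 'a" where
  "newton_poly 0 p = 1"
| "newton_poly (Suc n) p =
     (\<Sum>k\<le>n. (- 1) ^ k * newton_poly (n - k) p * p (Suc k)) / of_nat (Suc n)"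

definition elem_sym :: "'i set \<Rightarrow> ('i \<Rightarrow> 'a :: comm_ring_1) \<Rightarrow> nat \<Rightarrow> 'a" where
  "elem_sym A x l = (\<Sum>I | I \<subseteq> A \<and> card I = l. \<Prod>i\<in>I. x i)"

lemma elem_sym_0: "finite A \<Longrightarrow> elem_sym A x 0 = 1"
proof -
  assume "finite A"
  then have "{I. I \<subseteq> A \<and> card I = 0} = {{}}" by (auto dest: finite_subset)
  then show ?thesis by (simp add: elem_sym_def)
qed

lemma elem_sym_empty: "elem_sym {} x (Suc n) = 0"
  unfolding elem_sym_def by (rule sum.neutral) auto

lemma elem_sym_insert:
  assumes "finite A" "a \<notin> A"
  shows "elem_sym (insert a A) x (Suc n) = elem_sym A x (Suc n) + x a * elem_sym A x n"
proof -
  let ?S = "\<lambda>n. {I. I \<subseteq> A \<and> card I = n}"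
  have fin: "finite (?S n)" for n using assms(1) by simp
  have card_ins: "card (insert a I) = Suc (card I)" if "I \<subseteq> A" for I
    using that assms by (meson card_insert_disjoint finite_subset subsetD)
  have split: "{I. I \<subseteq> insert a A \<and> card I = Suc n} = ?S (Suc n) \<union> insert a ` ?S n"
  proof (rule Set.set_eqI, rule iffI)
    fix I assume I: "I \<in> {I. I \<subseteq> insert a A \<and> card I = Suc n}"
    show "I \<in> ?S (Suc n) \<union> insert a ` ?S n"
    proof (cases "a \<in> I")
      case True
      have "I - {a} \<subseteq> A" using I by auto
      moreover have "I = insert a (I - {a})" using True by auto
      moreover have "card (I - {a}) = n" using I True by simp
      ultimately show ?thesis by blast
    qed (use I in auto)
  qed (use card_ins in auto)
  have disj: "?S (Suc n) \<inter> insert a ` ?S n = {}" using assms(2) by auto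
  have inj: "inj_on (insert a) (?S n)"
    using assms(2) by (auto simp: inj_on_def dest: insert_ident[THEN iffD1, rotated 2])
  have "(\<Sum>I \<in> insert a ` ?S n. \<Prod>i\<in>I. x i) = (\<Sum>I \<in> ?S n. \<Prod>i\<in>insert a I. x i)"
    by (simp add: sum.reindex[OF inj])
  also have "\<dots> = (\<Sum>I \<in> ?S n. x a * (\<Prod>i\<in>I. x i))"
  proof (rule sum.cong[OF refl])
    fix I assume "I \<in> ?S n"
    then have "finite I" "a \<notin> I" using assms by (auto dest: finite_subset)
    then show "(\<Prod>i\<in>insert a I. x i) = x a * (\<Prod>i\<in>I. x i)" by simp
  qed
  finally show ?thesis
    unfolding elem_sym_def split sum.union_disjoint[OF fin finite_imageI[OF fin] disj]
    by (simp add: sum_distrib_left)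
qed

lemma newton_identity:
  assumes "finite A"
  shows "of_nat (Suc n) * elem_sym A x (Suc n) =
    (\<Sum>k\<le>n. (- 1) ^ k * elem_sym A x (n - k) * (\<Sum>i\<in>A. x i ^ Suc k))"
  using assms
proof (induction A arbitrary: n rule: finite_induct)
  case empty
  then show ?case by (simp add: elem_sym_empty)
next
  case (insert a A)
  let ?e = "elem_sym A x" and ?e' = "elem_sym (insert a A) x"
  let ?p = "\<lambda>k. \<Sum>i\<in>A. x i ^ Suc k"
  have e0: "?e 0 = 1" "?e' 0 = 1" using insert.hyps by (auto simp: elem_sym_0)
  have eS: "?e' (Suc m) = ?e (Suc m) + x a * ?e m" for m
    using insert.hyps by (rule elem_sym_insert)
  have split0: "(\<Sum>k\<le>n. (- 1) ^ k * ?e' (n - k) * g k) =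
      (\<Sum>k\<le>n. (- 1) ^ k * ?e (n - k) * g k) + x a * (\<Sum>k<n. (- 1) ^ k * ?e (n - Suc k) * g k)" for n g
  proof -
    have "(\<Sum>k<n. (- 1) ^ k * ?e' (n - k) * g k) =
        (\<Sum>k<n. (- 1) ^ k * ?e (n - k) * g k + x a * ((- 1) ^ k * ?e (n - Suc k) * g k))"
    proof (rule sum.cong[OF refl])
      fix k assume "k \<in> {..<n}"
      then have "n - k = Suc (n - Suc k)" by auto
      then show "(- 1) ^ k * ?e' (n - k) * g k =
          (- 1) ^ k * ?e (n - k) * g k + x a * ((- 1) ^ k * ?e (n - Suc k) * g k)"
        by (simp only: eS) (simp add: algebra_simps)
    qed
    then show ?thesis
      by (simp add: lessThan_Suc_atMost[symmetric] sum.distrib sum_distrib_left e0)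
  qed
  have tele: "(\<Sum>k\<le>n. (- 1) ^ k * ?e' (n - k) * x a ^ Suc k) = x a * ?e n"
  proof (induction n)
    case 0
    then show ?case by (simp add: e0)
  next
    case (Suc n)
    have "(\<Sum>k\<le>Suc n. (- 1) ^ k * ?e' (Suc n - k) * x a ^ Suc k) =
        ?e' (Suc n) * x a - x a * (\<Sum>k\<le>n. (- 1) ^ k * ?e' (n - k) * x a ^ Suc k)"
      by (subst sum.atMost_Suc_shift)
        (simp add: sum_distrib_left sum_negf mult_ac flip: sum_negf)
    also have "\<dots> = x a * ?e (Suc n)" unfolding Suc.IH eS by (simp add: algebra_simps)
    finally show ?case .
  qed
  have prev: "(\<Sum>k<n. (- 1) ^ k * ?e (n - Suc k) * ?p k) = of_nat n * ?e n"
  proof (cases n)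
    case (Suc m)
    show ?thesis unfolding Suc insert.IH by (simp add: lessThan_Suc_atMost)
  qed simp
  have "(\<Sum>k\<le>n. (- 1) ^ k * ?e' (n - k) * (\<Sum>i\<in>insert a A. x i ^ Suc k)) =
      (\<Sum>k\<le>n. (- 1) ^ k * ?e' (n - k) * x a ^ Suc k) + (\<Sum>k\<le>n. (- 1) ^ k * ?e' (n - k) * ?p k)"
    using insert.hyps by (simp add: sum.distrib[symmetric] distrib_left)
  also have "\<dots> = x a * ?e n + (of_nat (Suc n) * ?e (Suc n) + x a * (of_nat n * ?e n))"
    by (simp only: tele split0[of n ?p] prev insert.IH)
  also have "\<dots> = of_nat (Suc n) * ?e' (Suc n)"
    unfolding eS by (simp add: algebra_simps)
  finally show ?case ..
qed

text \<open>Newton polynomials express elementary symmetric functions through power sums.\<close>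

theorem newton_poly_power_sums:
  fixes x :: "'i \<Rightarrow> 'a :: field_char_0"
  assumes "finite A"
  shows "newton_poly l (\<lambda>m. \<Sum>i\<in>A. x i ^ m) = elem_sym A x l"
proof (induction l rule: less_induct)
  case (less l)
  show ?case
  proof (cases l)
    case 0
    then show ?thesis using assms by (simp add: elem_sym_0)
  next
    case (Suc n)
    have "newton_poly l (\<lambda>m. \<Sum>i\<in>A. x i ^ m) =
        (\<Sum>k\<le>n. (- 1) ^ k * elem_sym A x (n - k) * (\<Sum>i\<in>A. x i ^ Suc k)) / of_nat (Suc n)"
      unfolding Suc newton_poly.simps
      by (intro arg_cong2[where f = "(/)"] sum.cong refl) (simp add: less Suc)
    also have "\<dots> = elem_sym A x l"
      unfolding newton_identity[OF assms, symmetric] Suc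
      by (metis nonzero_mult_div_cancel_left of_nat_neq_0)
    finally show ?thesis .
  qed
qed

end

theory Submission
  imports Defs "Jordan_Normal_Form.Schur_Decomposition"
begin

text \<open>
  By the addition theorem, the Schur complement of the entry \<open>1\<close> in the Cauchy matrix
  \<open>(c(x\<^sub>i - x\<^sub>j))\<close> is the smaller Cauchy matrix with rows and columns rescaled, and the scale factors
  multiply to \<open>\<Prod> 1 / f(x\<^sub>i - x\<^sub>n)\<close>. Inductively, the determinant on \<open>I\<close> cancels the factors of
  \<open>\<Prod>j\<in>I. f {j}\<close> with both indices in \<open>I\<close>, so that the principal minor on \<open>I\<close> is
  \<open>exp (- \<beta> \<theta> I) f I\<close>. The reflection \<open>j \<mapsto> -j\<close> of the index set changes the sign of \<open>\<theta>\<close> and, since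
  \<open>f\<close> is even and \<open>T\<close>-periodic, preserves \<open>f I\<close>; hence both halves of the Hamiltonian agree.
\<close>

section \<open>Principal minors and traces of powers\<close>

lemma bij_betw_pick:
  assumes "finite S"
  shows "bij_betw (pick S) {0..<card S} S"
proof -
  have inj: "inj_on (pick S) {0..<card S}"
    by (rule linorder_inj_onI) (use pick_mono_le in \<open>force+\<close>)
  moreover have "pick S ` {0..<card S} \<subseteq> S"
    using pick_in_set_le by auto
  ultimately show ?thesis
    using assms by (simp add: bij_betw_def card_image card_subset_eq)
qed

lemma submatrix_principal:
  assumes "A \<in> carrier_mat n n" "S \<subseteq> {..<n}"
  shows "submatrix A S S = mat (card S) (card S) (\<lambda>(i, j). A $$ (pick S i, pick S j))"
proof -
  have "{i. i < n \<and> i \<in> S} = S" using assms(2) by auto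
  then show ?thesis using assms(1) by (simp add: submatrix_def)
qed

text \<open>Conjugation by \<open>pick S\<close> carries permutations of \<open>{0..<card S}\<close>
  to permutations of \<open>S\<close> and keeps signs. This form avoids renumbering, so minors on
  different subsets can be summed together.\<close>

lemma det_submatrix_principal:
  assumes A: "A \<in> carrier_mat n n" and S: "S \<subseteq> {..<n}"
  shows "det (submatrix A S S) =
    (\<Sum>p | p permutes S. of_int (sign p) * (\<Prod>i\<in>S. A $$ (i, p i)))"
proof -
  let ?T = "{0..<card S}" and ?h = "pick S"
  let ?m = "map_permutation ?T ?h"
  have h: "bij_betw ?h ?T S"
    using S by (intro bij_betw_pick) (auto intro: finite_subset)
  then have inj: "inj_on ?h ?T" and im: "?h ` ?T = S"
    by (auto simp: bij_betw_def)
  \<comment> \<open>Brings \<open>map_permutation\<close> into the explicit form used by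
    \<open>bij_betw_permutations\<close>.\<close>
  have "?m p = (\<lambda>x. if x \<in> S then ?h (p (inv_into ?T ?h x)) else x)" for p
    by (auto simp: map_permutation_def im restrict_id_def)
  with bij_betw_permutations[OF h]
  have m: "bij_betw ?m {p. p permutes ?T} {p. p permutes S}"
    by presburger
  have "det (submatrix A S S) = (\<Sum>p | p permutes ?T. of_int (sign p) *
      (\<Prod>i\<in>?T. submatrix A S S $$ (i, p i)))"
    by (rule det_def') (simp add: submatrix_principal[OF A S])
  also have "\<dots> = (\<Sum>p | p permutes ?T. of_int (sign (?m p)) * (\<Prod>i\<in>S. A $$ (i, ?m p i)))"
  proof (rule sum.cong[OF refl])
    fix p assume "p \<in> {p. p permutes ?T}"
    then have p: "p permutes ?T" by simp
    have "(\<Prod>i\<in>S. A $$ (i, ?m p i)) = (\<Prod>i\<in>?T. A $$ (?h i, ?m p (?h i)))"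
      by (rule prod.reindex_bij_betw[OF h, symmetric])
    also have "\<dots> = (\<Prod>i\<in>?T. submatrix A S S $$ (i, p i))"
    proof (rule prod.cong[OF refl])
      fix i assume "i \<in> ?T"
      moreover have "p i \<in> ?T" using p \<open>i \<in> ?T\<close> by (metis permutes_in_image)
      ultimately show "A $$ (?h i, ?m p (?h i)) = submatrix A S S $$ (i, p i)"
        using map_permutation_apply[OF inj] by (simp add: submatrix_principal[OF A S])
    qed
    finally show "of_int (sign p) * (\<Prod>i\<in>?T. submatrix A S S $$ (i, p i)) =
        of_int (sign (?m p)) * (\<Prod>i\<in>S. A $$ (i, ?m p i))"
      using sign_map_permutation[OF inj p] by simp
  qed
  also have "\<dots> = (\<Sum>p | p permutes S. of_int (sign p) * (\<Prod>i\<in>S. A $$ (i, p i)))"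
    by (rule sum.reindex_bij_betw[OF m])
  finally show ?thesis .
qed

text \<open>Multiplying out each Leibniz product selects the set \<open>S\<close> of rows that
  contribute an entry of \<open>A\<close>. The other rows contribute a diagonal term, which vanishes
  unless the permutation fixes them; what remains are the permutations of \<open>S\<close>.\<close>

lemma det_add_diagonal:
  fixes A :: "'a :: comm_ring_1 mat"
  assumes A: "A \<in> carrier_mat n n"
  shows "det (mat n n (\<lambda>(i, j). A $$ (i, j) + (if i = j then d i else 0))) =
    (\<Sum>S\<in>Pow {..<n}. det (submatrix A S S) * (\<Prod>i\<in>{..<n} - S. d i))"
    (is "det ?B = ?R")
proof -
  let ?U = "{..<n}"
  let ?P = "{p. p permutes ?U}"
  have "det ?B = (\<Sum>p\<in>?P. of_int (sign p) * (\<Prod>i\<in>?U. ?B $$ (i, p i)))"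
    by (subst det_def'[of _ n]) (simp_all add: atLeast0LessThan)
  also have "\<dots> = (\<Sum>p\<in>?P. of_int (sign p) *
      (\<Prod>i\<in>?U. A $$ (i, p i) + (if i = p i then d i else 0)))"
  proof (intro sum.cong refl arg_cong2[where f = "(*)"] prod.cong)
    fix p i assume "p \<in> ?P" "i \<in> ?U"
    moreover from this have "p i \<in> ?U" by (metis mem_Collect_eq permutes_in_image)
    ultimately show "?B $$ (i, p i) = A $$ (i, p i) + (if i = p i then d i else 0)" by simp
  qed
  also have "\<dots> = (\<Sum>p\<in>?P. \<Sum>S\<in>Pow ?U. of_int (sign p) *
      ((\<Prod>i\<in>S. A $$ (i, p i)) * (\<Prod>i\<in>?U - S. if i = p i then d i else 0)))"
    by (simp add: prod_add sum_distrib_left)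
  also have "\<dots> = (\<Sum>S\<in>Pow ?U. \<Sum>p\<in>?P. of_int (sign p) *
      ((\<Prod>i\<in>S. A $$ (i, p i)) * (\<Prod>i\<in>?U - S. if i = p i then d i else 0)))"
    by (rule sum.swap)
  also have "\<dots> = ?R"
  proof (rule sum.cong[OF refl])
    fix S assume "S \<in> Pow ?U"
    then have S: "S \<subseteq> ?U" by simp
    have sub: "{p. p permutes S} \<subseteq> ?P" using S by (auto intro: permutes_subset)
    have "(\<Sum>p\<in>?P. of_int (sign p) *
        ((\<Prod>i\<in>S. A $$ (i, p i)) * (\<Prod>i\<in>?U - S. if i = p i then d i else 0))) =
      (\<Sum>p | p permutes S. of_int (sign p) *
        ((\<Prod>i\<in>S. A $$ (i, p i)) * (\<Prod>i\<in>?U - S. if i = p i then d i else 0)))"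
    proof (rule sum.mono_neutral_right[OF _ sub])
      show "finite ?P" by (simp add: finite_permutations)
      show "\<forall>p\<in>?P - {p. p permutes S}. of_int (sign p) *
        ((\<Prod>i\<in>S. A $$ (i, p i)) * (\<Prod>i\<in>?U - S. if i = p i then d i else 0)) = 0"
      proof
        fix p assume p: "p \<in> ?P - {p. p permutes S}"
        \<comment> \<open>Fixing all of \<open>?U - S\<close> would make \<open>p\<close> a
          permutation of \<open>S\<close>.\<close>
        then have "\<exists>i\<in>?U - S. p i \<noteq> i"
          using permutes_superset[of p ?U S] by auto
        then have "(\<Prod>i\<in>?U - S. if i = p i then d i else 0) = 0"
          by (metis (mono_tags, lifting) finite_Diff finite_lessThan prod_zero)
        then show "of_int (sign p) *
          ((\<Prod>i\<in>S. A $$ (i, p i)) * (\<Prod>i\<in>?U - S. if i = p i then d i else 0)) = 0" by simp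
      qed
    qed
    also have "\<dots> = (\<Sum>p | p permutes S. of_int (sign p) * (\<Prod>i\<in>S. A $$ (i, p i)) *
        (\<Prod>i\<in>?U - S. d i))"
      by (intro sum.cong refl) (simp add: permutes_not_in mult.assoc)
    also have "\<dots> = det (submatrix A S S) * (\<Prod>i\<in>?U - S. d i)"
      by (simp add: det_submatrix_principal[OF A S] sum_distrib_right)
    finally show "(\<Sum>p\<in>?P. of_int (sign p) *
        ((\<Prod>i\<in>S. A $$ (i, p i)) * (\<Prod>i\<in>?U - S. if i = p i then d i else 0))) =
      det (submatrix A S S) * (\<Prod>i\<in>?U - S. d i)" .
  qed
  finally show ?thesis .
qed

section \<open>Coefficients of the characteristic polynomial\<close>

lemma coeff_sum_monom_Pow:
  fixes c :: "nat set \<Rightarrow> 'a :: comm_ring_1"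
  assumes "l \<le> n"
  shows "coeff (\<Sum>S\<in>Pow {..<n}. monom (c S) (n - card S)) (n - l) =
    (\<Sum>S | S \<subseteq> {..<n} \<and> card S = l. c S)"
proof -
  \<comment> \<open>Truncated subtraction loses nothing here: \<open>card S\<close> and
    \<open>l\<close> are both at most \<open>n\<close>.\<close>
  have "n - card S = n - l \<longleftrightarrow> card S = l" if "S \<subseteq> {..<n}" for S
    using assms card_mono[OF finite_lessThan that] by auto
  then have "{S \<in> Pow {..<n}. n - card S = n - l} = {S. S \<subseteq> {..<n} \<and> card S = l}"
    by auto
  then show ?thesis
    by (simp add: coeff_sum flip: sum.inter_filter)
qed

text \<open>The characteristic matrix is \<open>- A\<close> with the variable added along the
  diagonal, so \<open>det_add_diagonal\<close> sorts the polynomial by subsets \<open>S\<close>,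
  each in degree \<open>n - card S\<close>. The sign comes from the determinant of the negated
  minor.\<close>

lemma coeff_char_poly:
  fixes A :: "'a :: comm_ring_1 mat"
  assumes A: "A \<in> carrier_mat n n" and "l \<le> n"
  shows "coeff (char_poly A) (n - l) = (- 1) ^ l * sum_principal_minors l A"
proof -
  interpret hom: comm_ring_hom "\<lambda>a :: 'a. [:a:]"
    by unfold_locales auto
  let ?C = "map_mat (\<lambda>a. [:a:]) (- A)"
  have C: "?C \<in> carrier_mat n n" using A by simp
  have "char_poly_matrix A = mat n n (\<lambda>(i, j). ?C $$ (i, j) + (if i = j then monom 1 1 else 0))"
    using A by (auto simp: char_poly_matrix_def monom_altdef)
  then have "char_poly A =
      (\<Sum>S\<in>Pow {..<n}. det (submatrix ?C S S) * (\<Prod>i\<in>{..<n} - S. monom 1 1))"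
    by (simp add: char_poly_def det_add_diagonal[OF C])
  also have "\<dots> = (\<Sum>S\<in>Pow {..<n}. monom ((- 1) ^ card S * det (submatrix A S S)) (n - card S))"
  proof (rule sum.cong[OF refl])
    fix S assume "S \<in> Pow {..<n}"
    then have S: "S \<subseteq> {..<n}" by simp
    have cardS: "card ({..<n} - S) = n - card S"
      using S by (simp add: card_Diff_subset finite_subset)
    have pick: "pick S i < n" if "i < card S" for i
      using pick_in_set_le[OF that] S by auto
    have "submatrix ?C S S = map_mat (\<lambda>a. [:a:]) ((- 1) \<cdot>\<^sub>m submatrix A S S)"
      unfolding submatrix_principal[OF A S] submatrix_principal[OF C S]
      using A pick by auto
    then have "det (submatrix ?C S S) = [:(- 1) ^ card S * det (submatrix A S S):]"
      by (simp only: hom.hom_det det_smult) (simp add: submatrix_principal[OF A S])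
    then show "det (submatrix ?C S S) * (\<Prod>i\<in>{..<n} - S. monom 1 1) =
        monom ((- 1) ^ card S * det (submatrix A S S)) (n - card S)"
      by (simp add: cardS monom_power smult_monom)
  qed
  finally have "coeff (char_poly A) (n - l) =
      (\<Sum>S | S \<subseteq> {..<n} \<and> card S = l. (- 1) ^ card S * det (submatrix A S S))"
    by (simp only: coeff_sum_monom_Pow[OF \<open>l \<le> n\<close>])
  also have "\<dots> = (- 1) ^ l * sum_principal_minors l A"
    using A by (simp add: sum_principal_minors_def sum_distrib_left)
  finally show ?thesis .
qed

text \<open>Vieta's formula. Indexing the roots by \<open>{..<n}\<close> counts them with
  multiplicity, which makes the result comparable with \<open>coeff_char_poly\<close>.\<close>

lemma coeff_prod_linear:
  fixes e :: "nat \<Rightarrow> 'a :: comm_ring_1"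
  assumes "l \<le> n"
  shows "coeff (\<Prod>i<n. [:- e i, 1:]) (n - l) = (- 1) ^ l * elem_sym {..<n} e l"
proof -
  have "(\<Prod>i<n. [:- e i, 1:]) = (\<Prod>i<n. [:- e i:] + monom 1 1)"
    by (simp add: monom_altdef)
  also have "\<dots> = (\<Sum>S\<in>Pow {..<n}. (\<Prod>i\<in>S. [:- e i:]) * (\<Prod>i\<in>{..<n} - S. monom 1 1))"
    by (rule prod_add) simp
  also have "\<dots> = (\<Sum>S\<in>Pow {..<n}. monom ((- 1) ^ card S * (\<Prod>i\<in>S. e i)) (n - card S))"
  proof (rule sum.cong[OF refl])
    fix S assume "S \<in> Pow {..<n}"
    then have S: "S \<subseteq> {..<n}" "finite S" by (auto intro: finite_subset)
    have const: "(\<Prod>i\<in>S. [:f i:]) = [:\<Prod>i\<in>S. f i:]" for f :: "nat \<Rightarrow> 'a"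
      using S(2) by (induction S rule: finite_induct) (auto simp: one_pCons)
    show "(\<Prod>i\<in>S. [:- e i:]) * (\<Prod>i\<in>{..<n} - S. monom 1 1) =
        monom ((- 1) ^ card S * (\<Prod>i\<in>S. e i)) (n - card S)"
      using S by (simp add: const monom_power smult_monom card_Diff_subset prod_uminus)
  qed
  finally have "coeff (\<Prod>i<n. [:- e i, 1:]) (n - l) =
      (\<Sum>S | S \<subseteq> {..<n} \<and> card S = l. (- 1) ^ card S * (\<Prod>i\<in>S. e i))"
    by (simp only: coeff_sum_monom_Pow[OF assms])
  then show ?thesis
    by (simp add: elem_sym_def sum_distrib_left)
qed

section \<open>Traces of powers and Newton polynomials\<close>

lemma mat_trace_mult_commute:
  fixes A B :: "'a :: comm_semiring_0 mat"
  assumes "A \<in> carrier_mat n m" "B \<in> carrier_mat m n"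
  shows "mat_trace (A * B) = mat_trace (B * A)"
proof -
  have "mat_trace (A * B) = (\<Sum>i<n. \<Sum>k<m. A $$ (i, k) * B $$ (k, i))"
    using assms by (simp add: mat_trace_def scalar_prod_def lessThan_atLeast0)
  also have "\<dots> = (\<Sum>k<m. \<Sum>i<n. B $$ (k, i) * A $$ (i, k))"
    by (subst sum.swap) (simp add: mult.commute)
  also have "\<dots> = mat_trace (B * A)"
    using assms by (simp add: mat_trace_def scalar_prod_def lessThan_atLeast0)
  finally show ?thesis .
qed

lemma mat_trace_similar:
  fixes A B :: "'a :: comm_ring_1 mat"
  assumes "similar_mat_wit A B P Q"
  shows "mat_trace A = mat_trace B"
proof -
  define n where "n = dim_row A"
  note D = similar_mat_witD[OF n_def assms]
  have "mat_trace A = mat_trace (P * B * Q)" by (simp only: D(3))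
  also have "\<dots> = mat_trace (Q * (P * B))"
    by (rule mat_trace_mult_commute[of _ n n]) (use D(5-7) in auto)
  also have "Q * (P * B) = Q * P * B"
    by (rule assoc_mult_mat[symmetric, of _ n n _ n _ n]) (use D(5-7) in auto)
  also have "\<dots> = B" using D(2,5) by simp
  finally show ?thesis .
qed

text \<open>Both claims go through one induction: on the diagonal of the next power, the terms with
  \<open>k < i\<close> vanish by the first claim and those with \<open>k > i\<close> by
  triangularity of \<open>B\<close>.\<close>

lemma upper_triangular_pow:
  fixes B :: "'a :: semiring_1 mat"
  assumes B: "B \<in> carrier_mat n n" and ut: "upper_triangular B"
  shows "i < n \<Longrightarrow> j < i \<Longrightarrow> (B ^\<^sub>m m) $$ (i, j) = 0"
    and "i < n \<Longrightarrow> (B ^\<^sub>m m) $$ (i, i) = B $$ (i, i) ^ m"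
proof (induction m arbitrary: i j)
  case 0
  { case 1 then show ?case using B by simp }
  { case 2 then show ?case using B by simp }
next
  case (Suc m)
  have carr: "B ^\<^sub>m m \<in> carrier_mat n n" using B by (rule pow_carrier_mat)
  have entry: "(B ^\<^sub>m Suc m) $$ (i, j) = (\<Sum>k<n. (B ^\<^sub>m m) $$ (i, k) * B $$ (k, j))"
    if "i < n" "j < n" for i j
    using that B carr by (simp add: scalar_prod_def lessThan_atLeast0)
  have low: "B $$ (k, j) = 0" if "j < k" "k < n" for k j
    using upper_triangularD[OF ut that(1)] that(2) B by simp
  {
    case 1
    have "(B ^\<^sub>m m) $$ (i, k) * B $$ (k, j) = 0" if "k < n" for k
      using 1 that Suc.IH(1)[of i k] low[of j k] by (cases "k < i") auto
    then show ?case using 1 by (subst entry) auto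
  }
  {
    case 2
    have "(B ^\<^sub>m m) $$ (i, k) * B $$ (k, i) = (if k = i then B $$ (i, i) ^ Suc m else 0)"
      if "k < n" for k
      using 2 that Suc.IH(1)[of i k] Suc.IH(2)[of i] low[of i k]
      by (cases k i rule: linorder_cases) (auto simp: power_commutes)
    then show ?case using 2 by (subst entry) auto
  }
qed

text \<open>After Schur triangularisation both sides are symmetric functions of the diagonal of
  \<open>B\<close>: the minors through the characteristic polynomial, the traces through powers of a
  triangular matrix.\<close>

theorem sum_principal_minors_newton_poly:
  fixes A :: "complex mat"
  assumes A: "A \<in> carrier_mat n n"
  shows "sum_principal_minors l A = newton_poly l (\<lambda>m. mat_trace (A ^\<^sub>m m))"
proof -
  obtain es where es: "char_poly A = (\<Prod>e\<leftarrow>es. [:- e, 1:])"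
    using char_poly_factorized[OF A] by blast
  obtain B P Q where "schur_decomposition A es = (B, P, Q)"
    by (cases "schur_decomposition A es")
  from schur_decomposition[OF A es this]
  have sim: "similar_mat_wit A B P Q" and ut: "upper_triangular B" by auto
  have B: "B \<in> carrier_mat n n" using similar_mat_witD2[OF A sim] by simp
  let ?e = "\<lambda>i. B $$ (i, i)"
  have "char_poly A = char_poly B"
    using sim by (intro char_poly_similar) (auto simp: similar_mat_def)
  \<comment> \<open>The diagonal of \<open>B\<close> replaces the root list \<open>es\<close>,
    because the same entries also give the traces of the powers.\<close>
  also have "\<dots> = (\<Prod>i<n. [:- ?e i, 1:])"
    unfolding char_poly_upper_triangular[OF B ut] using B
    by (simp add: diag_mat_def prod.list_conv_set_nth lessThan_atLeast0 o_def)
  finally have cp: "char_poly A = (\<Prod>i<n. [:- ?e i, 1:])" .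
  have minors: "sum_principal_minors l A = elem_sym {..<n} ?e l"
  proof (cases "l \<le> n")
    case True
    have "(- 1) ^ l * sum_principal_minors l A = (- 1) ^ l * elem_sym {..<n} ?e l"
      using coeff_char_poly[OF A True] coeff_prod_linear[OF True, of ?e] cp by simp
    then show ?thesis by simp
  next
    case False
    then have "{S. S \<subseteq> {..<n} \<and> card S = l} = {}"
      using card_mono[OF finite_lessThan[of n]] by auto
    moreover have "dim_row A = n" using A by simp
    ultimately show ?thesis by (simp only: sum_principal_minors_def elem_sym_def sum.empty)
  qed
  have "mat_trace (A ^\<^sub>m m) = (\<Sum>i<n. ?e i ^ m)" for m
  proof -
    have "mat_trace (A ^\<^sub>m m) = mat_trace (B ^\<^sub>m m)"
      by (rule mat_trace_similar[OF similar_mat_wit_pow[OF sim]])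
    then show ?thesis
      using B upper_triangular_pow(2)[OF B ut] by (simp add: mat_trace_def)
  qed
  then show ?thesis
    by (simp add: minors newton_poly_power_sums)
qed

section \<open>The determinant of the Cauchy matrix\<close>

text \<open>The addition theorem in a form that serves twice: for general \<open>a\<close>,
  \<open>b\<close> it yields the Schur complement, and for \<open>b = - a\<close> it relates the
  scale factors to \<open>rs_f\<close>.\<close>

lemma sinh_shift_mult:
  fixes a b \<gamma> :: complex
  shows "sinh (a + \<gamma>) * sinh (b + \<gamma>) - sinh \<gamma> * sinh (a + b + \<gamma>) = sinh a * sinh b"
proof -
  have "sinh (a + \<gamma>) * sinh (b + \<gamma>) - sinh \<gamma> * sinh (a + b + \<gamma>) =
      sinh a * sinh b * ((cosh \<gamma>)\<^sup>2 - (sinh \<gamma>)\<^sup>2)"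
    unfolding sinh_add cosh_add by (simp add: algebra_simps power2_eq_square)
  then show ?thesis by (simp add: cosh_square_eq)
qed

lemma sinh_eq_0_imp:
  fixes z :: complex
  assumes "sinh z = 0"
  obtains n :: int where "z = \<i> * of_real (of_int n * pi)"
proof -
  have "exp (2 * z) = 1"
    using assms unfolding sinh_zero_iff by (auto simp: exp_double)
  \<comment> \<open>Real part and modulus of \<open>exp (2 * z) = 1\<close>: the modulus forces
    \<open>Re z = 0\<close>, and the real part then determines \<open>Im (2 * z)\<close> modulo full
    turns.\<close>
  then have *: "exp (Re (2 * z)) * cos (Im (2 * z)) = 1" "exp (Re (2 * z)) = 1"
    by (metis Re_exp one_complex.sel(1), metis norm_exp_eq_Re norm_one)
  from *(2) have re: "Re z = 0" by simp
  from * have "cos (Im (2 * z)) = 1" using * by simp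
  then obtain n :: int where "Im (2 * z) = of_int n * 2 * pi"
    using cos_one_2pi_int by blast
  then have "z = \<i> * of_real (of_int n * pi)"
    using re by (simp add: complex_eq_iff)
  then show ?thesis by (rule that)
qed

text \<open>Elimination with the last entry as pivot. As the pivot sits in the lower right corner,
  the block factorisation is upper times lower triangular, and the remaining rows keep their
  numbers.\<close>

lemma det_pivot_one:
  fixes M :: "nat \<Rightarrow> nat \<Rightarrow> 'a :: idom"
  assumes "M n n = 1"
  shows "det (mat (Suc n) (Suc n) (\<lambda>(i, j). M i j)) =
    det (mat n n (\<lambda>(i, j). M i j - M i n * M n j))"
proof -
  let ?S = "mat n n (\<lambda>(i, j). M i j - M i n * M n j)"
  let ?B = "mat n 1 (\<lambda>(i, j). M i n)" and ?C = "mat 1 n (\<lambda>(i, j). M n j)"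
  let ?U = "four_block_mat ?S ?B (0\<^sub>m 1 n) (1\<^sub>m 1)"
  let ?L = "four_block_mat (1\<^sub>m n) (0\<^sub>m n 1) ?C (1\<^sub>m 1)"
  have "?U * ?L = four_block_mat (?S * 1\<^sub>m n + ?B * ?C) (?S * 0\<^sub>m n 1 + ?B * 1\<^sub>m 1)
      (0\<^sub>m 1 n * 1\<^sub>m n + 1\<^sub>m 1 * ?C) (0\<^sub>m 1 n * 0\<^sub>m n 1 + 1\<^sub>m 1 * 1\<^sub>m 1)"
    by (rule mult_four_block_mat) auto
  also have "\<dots> = mat (Suc n) (Suc n) (\<lambda>(i, j). M i j)"
    using assms by (auto intro!: eq_matI simp: scalar_prod_def less_Suc_eq)
  finally have "det (mat (Suc n) (Suc n) (\<lambda>(i, j). M i j)) = det (?U * ?L)" by simp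
  also have "\<dots> = det ?U * det ?L"
    by (rule det_mult[of _ "n + 1"]) auto
  also have "det ?U = det ?S * det (1\<^sub>m 1 :: 'a mat)"
    by (rule det_four_block_mat_lower_left_zero) auto
  also have "det ?L = det (1\<^sub>m n :: 'a mat) * det (1\<^sub>m 1 :: 'a mat)"
    by (rule det_four_block_mat_upper_right_zero) auto
  finally show ?thesis by simp
qed

text \<open>In every Leibniz term the column factors \<open>s (p i)\<close> run once through all
  columns, so the same scalar factors out of each term.\<close>

lemma det_scale_rows_columns:
  fixes M :: "nat \<Rightarrow> nat \<Rightarrow> 'a :: comm_ring_1"
  shows "det (mat n n (\<lambda>(i, j). M i j * (r i * s j))) =
    det (mat n n (\<lambda>(i, j). M i j)) * (\<Prod>i<n. r i * s i)"
proof -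
  let ?P = "{p. p permutes {0..<n}}"
  have less: "p i < n" if "p permutes {0..<n}" "i < n" for p i
    using permutes_in_image[OF that(1), of i] that(2) by simp
  have "det (mat n n (\<lambda>(i, j). M i j * (r i * s j))) =
      (\<Sum>p\<in>?P. of_int (sign p) * (\<Prod>i = 0..<n. M i (p i) * (r i * s (p i))))"
    by (subst det_def'[of _ n]) (auto intro!: sum.cong prod.cong simp: less)
  also have "\<dots> = (\<Sum>p\<in>?P. of_int (sign p) * (\<Prod>i = 0..<n. M i (p i)) * (\<Prod>i<n. r i * s i))"
  proof (rule sum.cong[OF refl])
    fix p assume "p \<in> ?P"
    then have "(\<Prod>i = 0..<n. s (p i)) = (\<Prod>i = 0..<n. s i)"
      using prod.permute[of p "{0..<n}" s] by (simp add: o_def)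
    then show "of_int (sign p) * (\<Prod>i = 0..<n. M i (p i) * (r i * s (p i))) =
        of_int (sign p) * (\<Prod>i = 0..<n. M i (p i)) * (\<Prod>i<n. r i * s i)"
      by (simp add: prod.distrib lessThan_atLeast0 mult.assoc)
  qed
  also have "\<dots> = det (mat n n (\<lambda>(i, j). M i j)) * (\<Prod>i<n. r i * s i)"
    by (subst det_def'[of _ n])
      (auto intro!: sum.cong prod.cong simp: less sum_distrib_right)
  finally show ?thesis .
qed

section \<open>Properties of f and c, and the Schur complement of the Cauchy matrix\<close>

lemma rs_f_even: "rs_f \<nu> \<gamma> (- q) = rs_f \<nu> \<gamma> q"
  by (simp add: rs_f_def)

lemma rs_f_period:
  assumes "\<nu> \<noteq> 0"
  shows "rs_f \<nu> \<gamma> (q + rs_period \<nu>) = rs_f \<nu> \<gamma> q"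
proof -
  \<comment> \<open>A period adds \<open>\<i> * pi\<close> to the argument of \<open>sinh\<close>
    and so changes its sign, which the square in \<open>rs_f\<close> absorbs.\<close>
  have "\<nu> * (q + rs_period \<nu>) / 2 = \<nu> * q / 2 + \<i> * of_real pi"
    using assms by (simp add: rs_period_def field_simps)
  moreover have "sinh (z + \<i> * of_real pi) = - sinh z" for z :: complex
    by (simp add: sinh_field_def exp_add exp_minus exp_diff minus_add_distrib field_simps)
  ultimately show ?thesis by (simp only: rs_f_def power2_minus)
qed

lemma rs_c_0: "sinh \<gamma> \<noteq> 0 \<Longrightarrow> rs_c \<nu> \<gamma> 0 = 1"
  by (simp add: rs_c_def)

text \<open>The factor that elimination attaches to a row or a column, evaluated at the coordinate
  difference to or from the pivot.\<close>

definition rs_schur :: "complex \<Rightarrow> complex \<Rightarrow> complex \<Rightarrow> complex" where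
  "rs_schur \<nu> \<gamma> q = sinh (\<nu> * q / 2) / sinh (\<nu> * q / 2 + \<gamma>)"

text \<open>For \<open>a = y i - y n\<close> and \<open>b = y n - y j\<close> the left side is the
  \<open>(i, j)\<close> entry of the Schur complement at pivot \<open>n\<close>; over a common
  denominator its numerator is given by \<open>sinh_shift_mult\<close>.\<close>

lemma rs_c_schur:
  assumes "sinh (\<nu> * a / 2 + \<gamma>) \<noteq> 0" "sinh (\<nu> * b / 2 + \<gamma>) \<noteq> 0"
    "sinh (\<nu> * (a + b) / 2 + \<gamma>) \<noteq> 0"
  shows "rs_c \<nu> \<gamma> (a + b) - rs_c \<nu> \<gamma> a * rs_c \<nu> \<gamma> b =
    rs_c \<nu> \<gamma> (a + b) * (rs_schur \<nu> \<gamma> a * rs_schur \<nu> \<gamma> b)"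
proof -
  let ?a = "\<nu> * a / 2" and ?b = "\<nu> * b / 2"
  have ab: "\<nu> * (a + b) / 2 = ?a + ?b" by (simp add: field_simps)
  \<comment> \<open>Here \<open>s\<close> stands for \<open>sinh \<gamma>\<close>, \<open>p\<close>
    and \<open>r\<close> for the unshifted sines, and \<open>x\<close>, \<open>y\<close>,
    \<open>z\<close> for the shifted ones at \<open>a\<close>, \<open>b\<close> and
    \<open>a + b\<close>.\<close>
  have *: "s / z - s / x * (s / y) = s / z * (p / x * (r / y))"
    if "x * y - s * z = p * r" "x \<noteq> 0" "y \<noteq> 0" "z \<noteq> 0" for p r s x y z :: complex
  proof -
    have "s / z * (p / x * (r / y)) = s * (x * y - s * z) / (z * x * y)"
      by (simp add: that(1))
    also have "\<dots> = s / z - s / x * (s / y)"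
      using that(2-4) by (simp add: field_simps)
    finally show ?thesis by simp
  qed
  show ?thesis
    unfolding rs_c_def rs_schur_def ab
    by (rule *[OF sinh_shift_mult]) (use assms in \<open>simp_all only: ab not_False_eq_True\<close>)
qed

lemma rs_schur_rs_f:
  assumes "sinh (\<nu> * a / 2) \<noteq> 0" "sinh (\<nu> * a / 2 + \<gamma>) \<noteq> 0" "sinh (\<nu> * (- a) / 2 + \<gamma>) \<noteq> 0"
  shows "rs_schur \<nu> \<gamma> a * rs_schur \<nu> \<gamma> (- a) * rs_f \<nu> \<gamma> a = 1"
proof -
  let ?a = "\<nu> * a / 2"
  have "sinh (?a + \<gamma>) * sinh (- ?a + \<gamma>) = (sinh \<gamma>)\<^sup>2 - (sinh ?a)\<^sup>2"
    using sinh_shift_mult[of ?a \<gamma> "- ?a"] by (simp add: algebra_simps power2_eq_square)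
  moreover have "rs_f \<nu> \<gamma> a = ((sinh ?a)\<^sup>2 - (sinh \<gamma>)\<^sup>2) / (sinh ?a)\<^sup>2"
    using assms(1) by (simp add: rs_f_def field_simps)
  ultimately have "rs_f \<nu> \<gamma> a = - (sinh (?a + \<gamma>) * sinh (- ?a + \<gamma>)) / (sinh ?a)\<^sup>2"
    by simp
  then show ?thesis
    using assms by (simp add: rs_schur_def power2_eq_square)
qed

text \<open>By evenness both factors are the same principal root, so their product carries no branch
  ambiguity.\<close>

lemma csqrt_rs_f_mult: "csqrt (rs_f \<nu> \<gamma> a) * csqrt (rs_f \<nu> \<gamma> (- a)) = rs_f \<nu> \<gamma> a"
  using power2_csqrt[of "rs_f \<nu> \<gamma> a"] by (simp add: rs_f_even power2_eq_square)

text \<open>Induction with the last point as pivot: by \<open>rs_schur_rs_f\<close> the new scale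
  factors cancel the roots joining this point to the earlier ones. The product form avoids dividing
  by roots.\<close>

lemma det_rs_c:
  fixes y :: "nat \<Rightarrow> complex"
  assumes s: "\<And>i j. i < n \<Longrightarrow> j < n \<Longrightarrow> i \<noteq> j \<Longrightarrow> sinh (\<nu> * (y i - y j) / 2) \<noteq> 0"
    and c: "\<And>i j. i < n \<Longrightarrow> j < n \<Longrightarrow> sinh (\<nu> * (y i - y j) / 2 + \<gamma>) \<noteq> 0"
  shows "det (mat n n (\<lambda>(i, j). rs_c \<nu> \<gamma> (y i - y j))) *
    (\<Prod>j<n. \<Prod>k\<in>{..<n} - {j}. csqrt (rs_f \<nu> \<gamma> (y j - y k))) = 1"
  using assms
proof (induction n)
  case 0
  then show ?case by simp
next
  case (Suc n)
  let ?c = "\<lambda>i j. rs_c \<nu> \<gamma> (y i - y j)" and ?r = "\<lambda>i j. csqrt (rs_f \<nu> \<gamma> (y i - y j))"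
  let ?h = "\<lambda>i j. rs_schur \<nu> \<gamma> (y i - y j)"
  \<comment> \<open>The diagonal case of the assumption on denominators; it makes the pivot equal to
    1.\<close>
  have "sinh \<gamma> \<noteq> 0" using Suc.prems(2)[of n n] by simp
  then have "det (mat (Suc n) (Suc n) (\<lambda>(i, j). ?c i j)) =
      det (mat n n (\<lambda>(i, j). ?c i j - ?c i n * ?c n j))"
    by (intro det_pivot_one) (simp add: rs_c_0)
  also have "mat n n (\<lambda>(i, j). ?c i j - ?c i n * ?c n j) =
      mat n n (\<lambda>(i, j). ?c i j * (?h i n * ?h n j))"
  proof (rule cong_mat)
    fix i j assume ij: "i < n" "j < n"
    then show "(case (i, j) of (i, j) \<Rightarrow> ?c i j - ?c i n * ?c n j) =
        (case (i, j) of (i, j) \<Rightarrow> ?c i j * (?h i n * ?h n j))"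
      using rs_c_schur[of \<nu> "y i - y n" \<gamma> "y n - y j"] Suc.prems(2)[of i j]
        Suc.prems(2)[of i n] Suc.prems(2)[of n j] by simp
  qed auto
  also have "det \<dots> = det (mat n n (\<lambda>(i, j). ?c i j)) * (\<Prod>i<n. ?h i n * ?h n i)"
    by (rule det_scale_rows_columns)
  finally have det: "det (mat (Suc n) (Suc n) (\<lambda>(i, j). ?c i j)) =
      det (mat n n (\<lambda>(i, j). ?c i j)) * (\<Prod>i<n. ?h i n * ?h n i)" .
  let ?D = "det (mat n n (\<lambda>(i, j). ?c i j))" and ?R = "\<lambda>j. \<Prod>k\<in>{..<n} - {j}. ?r j k"
  \<comment> \<open>The step to \<open>Suc n\<close> adds one root to each old row, and one new row
    of roots.\<close>
  have "(\<Prod>k\<in>{..<Suc n} - {j}. ?r j k) = ?r j n * ?R j" if "j < n" for j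
  proof -
    have "{..<Suc n} - {j} = insert n ({..<n} - {j})" using that by auto
    then show ?thesis by simp
  qed
  then have "(\<Prod>j<n. \<Prod>k\<in>{..<Suc n} - {j}. ?r j k) = (\<Prod>j<n. ?r j n * ?R j)"
    by (intro prod.cong) auto
  moreover have "{..<Suc n} - {n} = {..<n}" by auto
  ultimately have prods: "(\<Prod>j<Suc n. \<Prod>k\<in>{..<Suc n} - {j}. ?r j k) =
      (\<Prod>j<n. ?r j n * ?R j) * (\<Prod>k<n. ?r n k)"
    by (simp only: prod.lessThan_Suc)
  have one: "(\<Prod>i<n. ?h i n * ?h n i * (?r i n * ?r n i)) = 1"
  proof (rule prod.neutral, rule ballI)
    fix i assume i: "i \<in> {..<n}"
    have "?r i n * ?r n i = rs_f \<nu> \<gamma> (y i - y n)"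
      using csqrt_rs_f_mult[of \<nu> \<gamma> "y i - y n"] by (simp only: minus_diff_eq)
    moreover have "?h i n * ?h n i * rs_f \<nu> \<gamma> (y i - y n) = 1"
      by (rule rs_schur_rs_f[of \<nu> "y i - y n" \<gamma>, unfolded minus_diff_eq];
          rule Suc.prems) (use i in auto)
    ultimately show "?h i n * ?h n i * (?r i n * ?r n i) = 1" by (simp only:)
  qed
  have IH: "?D * (\<Prod>j<n. ?R j) = 1"
    by (rule Suc.IH) (rule Suc.prems; simp)+
  have "det (mat (Suc n) (Suc n) (\<lambda>(i, j). ?c i j)) *
      (\<Prod>j<Suc n. \<Prod>k\<in>{..<Suc n} - {j}. ?r j k) =
      ?D * (\<Prod>j<n. ?R j) * (\<Prod>i<n. ?h i n * ?h n i * (?r i n * ?r n i))"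
    unfolding det prods prod.distrib by (simp only: mult_ac)
  then show ?case by (simp only: IH one mult_1)
qed

section \<open>Principal minors over an arbitrary finite index set\<close>

lemma rs_weight_singletons:
  assumes J: "finite J" and I: "I \<subseteq> J"
  shows "(\<Prod>j\<in>I. rs_weight \<nu> \<gamma> J x {j}) =
    rs_weight \<nu> \<gamma> J x I * (\<Prod>j\<in>I. \<Prod>k\<in>I - {j}. csqrt (rs_f \<nu> \<gamma> (x j - x k)))"
proof -
  let ?r = "\<lambda>j k. csqrt (rs_f \<nu> \<gamma> (x j - x k))"
  have fin: "finite I" using I J by (rule finite_subset)
  have "rs_weight \<nu> \<gamma> J x {j} = (\<Prod>k\<in>J - I. ?r j k) * (\<Prod>k\<in>I - {j}. ?r j k)" if "j \<in> I" for j
  proof -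
    \<comment> \<open>The part outside \<open>I\<close> contributes to the weight of
      \<open>I\<close>; the part inside gives the roots that the Cauchy determinant cancels.\<close>
    have "J - {j} = (J - I) \<union> (I - {j})" using that I by auto
    moreover have "rs_weight \<nu> \<gamma> J x {j} = (\<Prod>k\<in>J - {j}. ?r j k)"
      unfolding rs_weight_def by (subst prod.cartesian_product[symmetric]) simp
    moreover have "(J - I) \<inter> (I - {j}) = {}" by auto
    ultimately show ?thesis
      using J fin by (simp add: prod.union_disjoint del: Un_Diff_cancel2)
  qed
  moreover have "rs_weight \<nu> \<gamma> J x I = (\<Prod>j\<in>I. \<Prod>k\<in>J - I. ?r j k)"
    by (simp add: rs_weight_def prod.cartesian_product)
  ultimately show ?thesis by (simp add: prod.distrib)
qed

lemma rs_principal_minor: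
  assumes J: "finite J" and I: "I \<subseteq> J" and g: "bij_betw g {..<l} I"
    and s: "\<And>i k. i \<in> I \<Longrightarrow> k \<in> I \<Longrightarrow> i \<noteq> k \<Longrightarrow> sinh (\<nu> * (x i - x k) / 2) \<noteq> 0"
    and c: "\<And>i k. i \<in> I \<Longrightarrow> k \<in> I \<Longrightarrow> sinh (\<nu> * (x i - x k) / 2 + \<gamma>) \<noteq> 0"
  shows "det (mat l l (\<lambda>(i, j). rs_c \<nu> \<gamma> (x (g i) - x (g j)) * exp (- \<beta> * \<theta> (g j)) *
      rs_weight \<nu> \<gamma> J x {g j})) = exp (- \<beta> * (\<Sum>i\<in>I. \<theta> i)) * rs_weight \<nu> \<gamma> J x I"
    (is "det ?L = _")
proof -
  let ?C = "mat l l (\<lambda>(i, j). rs_c \<nu> \<gamma> (x (g i) - x (g j)))"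
  let ?r = "\<lambda>j k. csqrt (rs_f \<nu> \<gamma> (x j - x k))"
  have inj: "g i = g j \<longleftrightarrow> i = j" if "i < l" "j < l" for i j
    using g that by (auto simp: bij_betw_def inj_on_def)
  have gI: "g i \<in> I" if "i < l" for i
    using g that by (auto simp: bij_betw_def)
  have fin: "finite I" using I J by (rule finite_subset)
  \<comment> \<open>Exponential and weight depend on the column only, so the row factor is
    1.\<close>
  have "?L = mat l l (\<lambda>(i, j). rs_c \<nu> \<gamma> (x (g i) - x (g j)) *
      (1 * (exp (- \<beta> * \<theta> (g j)) * rs_weight \<nu> \<gamma> J x {g j})))"
    by (simp add: mult.assoc)
  then have "det ?L = det ?C * (\<Prod>j<l. 1 * (exp (- \<beta> * \<theta> (g j)) * rs_weight \<nu> \<gamma> J x {g j}))"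
    by (simp only: det_scale_rows_columns)
  also have "\<dots> = det ?C * (\<Prod>j\<in>I. exp (- \<beta> * \<theta> j) * rs_weight \<nu> \<gamma> J x {j})"
    using prod.reindex_bij_betw[OF g, of "\<lambda>j. exp (- \<beta> * \<theta> j) * rs_weight \<nu> \<gamma> J x {j}"] by simp
  also have "\<dots> = exp (- \<beta> * (\<Sum>i\<in>I. \<theta> i)) * rs_weight \<nu> \<gamma> J x I *
      (det ?C * (\<Prod>j\<in>I. \<Prod>k\<in>I - {j}. ?r j k))"
    by (simp add: prod.distrib rs_weight_singletons[OF J I] exp_sum[OF fin] sum_distrib_left
        flip: sum_negf)
  also have "(\<Prod>j\<in>I. \<Prod>k\<in>I - {j}. ?r j k) = (\<Prod>j<l. \<Prod>k\<in>I - {g j}. ?r (g j) k)"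
    by (rule prod.reindex_bij_betw[OF g, symmetric])
  also have "\<dots> = (\<Prod>j<l. \<Prod>k\<in>{..<l} - {j}. ?r (g j) (g k))"
  proof (rule prod.cong[OF refl])
    fix j assume "j \<in> {..<l}"
    then have "bij_betw g ({..<l} - {j}) (I - {g j})"
      using g by (intro bij_betw_DiffI) (auto simp: bij_betw_def)
    then show "(\<Prod>k\<in>I - {g j}. ?r (g j) k) = (\<Prod>k\<in>{..<l} - {j}. ?r (g j) (g k))"
      by (rule prod.reindex_bij_betw[symmetric])
  qed
  also have "det ?C * \<dots> = 1"
    by (rule det_rs_c[of l \<nu> "\<lambda>i. x (g i)"]) (use s c inj gI in auto)
  finally show ?thesis by simp
qed

section \<open>The folding\<close>

text \<open>Reindexes sums over \<open>l\<close>-element subsets, along both the reflection and the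
  enumeration of the indices.\<close>

lemma bij_betw_image_subsets_card:
  assumes "bij_betw f A B"
  shows "bij_betw (image f) {S. S \<subseteq> A \<and> card S = l} {I. I \<subseteq> B \<and> card I = l}"
    (is "bij_betw _ ?S ?T")
proof -
  have inj: "inj_on f A" and B: "f ` A = B" using assms by (auto simp: bij_betw_def)
  have card: "card (f ` S) = card S" if "S \<subseteq> A" for S
    using inj that by (metis card_image inj_on_subset)
  have "image f ` ?S = ?T"
  proof (intro subset_antisym subsetI)
    fix I assume I: "I \<in> ?T"
    then obtain S where "S \<subseteq> A" "I = f ` S" using B by (metis mem_Collect_eq subset_image_iff)
    then show "I \<in> image f ` ?S" using I card by simp
  qed (use B card in auto)
  moreover have "inj_on (image f) ?S"
    using inj_on_image_Pow[OF inj] by (rule inj_on_subset) auto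
  ultimately show ?thesis by (simp add: bij_betw_def)
qed

section \<open>The reflection of the index set\<close>

fun neg_index :: "index \<Rightarrow> index" where
  "neg_index (Idx k) = Idx (- k)"
| "neg_index ZeroBar = ZeroBar"

lemma neg_index_neg_index [simp]: "neg_index (neg_index i) = i"
  by (cases i) auto

lemma inj_on_neg_index: "inj_on neg_index A"
  by (metis inj_onI neg_index_neg_index)

lemma neg_index_in_indices: "i \<in> indices N \<Longrightarrow> neg_index i \<in> indices N"
  by (cases i) (auto simp: indices_def)

lemma neg_index_image_indices: "neg_index ` indices N = indices N"
proof (intro subset_antisym subsetI)
  fix i assume "i \<in> indices N"
  then show "i \<in> neg_index ` indices N"
    by (intro image_eqI[of _ _ "neg_index i"]) (simp_all add: neg_index_in_indices)
qed (auto intro: neg_index_in_indices)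

lemma fold_theta_neg_index: "fold_theta \<theta> (neg_index i) = - fold_theta \<theta> i"
  by (cases i) auto

lemma rs_f_fold_q_neg_index:
  assumes "\<nu> \<noteq> 0"
  shows "rs_f \<nu> \<gamma> (fold_q \<nu> q (neg_index i) - fold_q \<nu> q (neg_index k)) =
    rs_f \<nu> \<gamma> (fold_q \<nu> q i - fold_q \<nu> q k)"
proof -
  \<comment> \<open>\<open>ZeroBar\<close> is its own mirror image; half a period is its own
    negative plus one period. Differences therefore change sign up to a period, which
    \<open>rs_f\<close> does not see.\<close>
  have neg: "fold_q \<nu> q (neg_index i) = - fold_q \<nu> q i + (if i = ZeroBar then rs_period \<nu> else 0)"
    for i by (cases i) auto
  have minus: "rs_f \<nu> \<gamma> (a - rs_period \<nu>) = rs_f \<nu> \<gamma> a" for a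
    using rs_f_period[OF assms, of \<gamma> "a - rs_period \<nu>"] by simp
  have "rs_f \<nu> \<gamma> (- a + (if P then rs_period \<nu> else 0) - (- b + (if Q then rs_period \<nu> else 0))) =
      rs_f \<nu> \<gamma> (- (a - b))" for a b P Q
    using rs_f_period[OF assms, of \<gamma> "b - a"] minus[of "b - a"] by (simp add: algebra_simps)
  then show ?thesis unfolding neg rs_f_even .
qed

lemma finite_indices: "finite (indices N)"
  by (simp add: indices_def)

lemma rs_weight_neg_index:
  assumes "\<nu> \<noteq> 0"
  shows "rs_weight \<nu> \<gamma> (indices N) (fold_q \<nu> q) (neg_index ` I) =
    rs_weight \<nu> \<gamma> (indices N) (fold_q \<nu> q) I"
proof -
  have "indices N - neg_index ` I = neg_index ` (indices N - I)"
    by (simp add: image_set_diff inj_on_neg_index neg_index_image_indices)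
  then have "rs_weight \<nu> \<gamma> (indices N) (fold_q \<nu> q) (neg_index ` I) =
      (\<Prod>i\<in>neg_index ` I. \<Prod>k\<in>neg_index ` (indices N - I).
        csqrt (rs_f \<nu> \<gamma> (fold_q \<nu> q i - fold_q \<nu> q k)))"
    by (simp add: rs_weight_def prod.cartesian_product)
  also have "\<dots> = rs_weight \<nu> \<gamma> (indices N) (fold_q \<nu> q) I"
    unfolding prod.reindex[OF inj_on_neg_index] o_def rs_f_fold_q_neg_index[OF assms]
    by (simp add: rs_weight_def prod.cartesian_product)
  finally show ?thesis .
qed

text \<open>Reflecting \<open>I\<close> negates its sum of \<open>\<theta>\<close> and keeps its
  weight, so the second sum equals the first and the factor 1/2 drops out.\<close>

lemma C2_hamiltonian_eq:
  assumes "\<nu> \<noteq> 0"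
  shows "C2_hamiltonian \<beta> \<nu> \<gamma> N q \<theta> l =
    (\<Sum>I | I \<subseteq> indices N \<and> card I = l.
      exp (- \<beta> * (\<Sum>i\<in>I. fold_theta \<theta> i)) * rs_weight \<nu> \<gamma> (indices N) (fold_q \<nu> q) I)"
proof -
  let ?S = "{I. I \<subseteq> indices N \<and> card I = l}"
  have "bij_betw (image neg_index) ?S ?S"
    by (rule bij_betw_image_subsets_card)
      (simp add: bij_betw_def inj_on_neg_index neg_index_image_indices)
  from sum.reindex_bij_betw[OF this, symmetric, of "\<lambda>I. exp (\<beta> * (\<Sum>i\<in>I. fold_theta \<theta> i)) *
      rs_weight \<nu> \<gamma> (indices N) (fold_q \<nu> q) I"]
  have "(\<Sum>I\<in>?S. exp (\<beta> * (\<Sum>i\<in>I. fold_theta \<theta> i)) *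
        rs_weight \<nu> \<gamma> (indices N) (fold_q \<nu> q) I) =
      (\<Sum>I\<in>?S. exp (- \<beta> * (\<Sum>i\<in>I. fold_theta \<theta> i)) *
        rs_weight \<nu> \<gamma> (indices N) (fold_q \<nu> q) I)"
    by (simp add: rs_weight_neg_index[OF assms] sum.reindex[OF inj_on_neg_index]
        fold_theta_neg_index sum_negf)
  then show ?thesis
    by (simp add: C2_hamiltonian_def rs_hamiltonian_def)
qed

lemma C2_hamiltonian_sum_principal_minors:
  assumes \<nu>: "\<nu> \<noteq> 0"
    and distinct_mod_T: "\<And>i k. i \<in> indices N \<Longrightarrow> k \<in> indices N \<Longrightarrow> i \<noteq> k \<Longrightarrow>
           \<not> (\<exists>n::int. fold_q \<nu> q i - fold_q \<nu> q k = of_int n * rs_period \<nu>)"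
    and c_finite: "\<And>i k. i \<in> indices N \<Longrightarrow> k \<in> indices N \<Longrightarrow>
           sinh (\<nu> * (fold_q \<nu> q i - fold_q \<nu> q k) / 2 + \<gamma>) \<noteq> 0"
  shows "C2_hamiltonian \<beta> \<nu> \<gamma> N q \<theta> l = sum_principal_minors l (C2_lax \<beta> \<nu> \<gamma> N q \<theta>)"
proof -
  let ?n = "2 * N + 2" and ?J = "indices N" and ?x = "fold_q \<nu> q"
  let ?h = "\<lambda>a. index_list N ! a" and ?L = "C2_lax \<beta> \<nu> \<gamma> N q \<theta>"
  let ?F = "\<lambda>I. exp (- \<beta> * (\<Sum>i\<in>I. fold_theta \<theta> i)) * rs_weight \<nu> \<gamma> ?J ?x I"
  \<comment> \<open>A zero of \<open>sinh\<close> would make the two coordinates congruent modulo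
    the period.\<close>
  have s: "sinh (\<nu> * (?x i - ?x k) / 2) \<noteq> 0" if "i \<in> ?J" "k \<in> ?J" "i \<noteq> k" for i k
  proof
    assume "sinh (\<nu> * (?x i - ?x k) / 2) = 0"
    then obtain n :: int where "\<nu> * (?x i - ?x k) / 2 = \<i> * of_real (of_int n * pi)"
      by (rule sinh_eq_0_imp)
    then have "?x i - ?x k = of_int n * rs_period \<nu>"
      using \<nu> by (simp add: rs_period_def field_simps)
    with distinct_mod_T[OF that] show False by blast
  qed
  have h: "bij_betw ?h {..<?n} ?J"
    by (rule bij_betw_nth) (simp_all add: distinct_index_list length_index_list set_index_list)
  have L: "?L \<in> carrier_mat ?n ?n" by (simp add: C2_lax_def)
  have minor: "det (submatrix ?L S S) = ?F (?h ` S)" if S: "S \<subseteq> {..<?n}" "card S = l" for S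
  proof -
    \<comment> \<open>Row \<open>a\<close> of the submatrix is row \<open>pick S a\<close> of the
      Lax matrix, which belongs to the index \<open>?g a\<close>.\<close>
    let ?g = "\<lambda>a. ?h (pick S a)"
    have "finite S" using S(1) by (auto intro: finite_subset)
    from bij_betw_pick[OF this] have pick: "bij_betw (pick S) {..<l} S"
      by (simp add: S(2) lessThan_atLeast0)
    moreover have "bij_betw ?h S (?h ` S)"
      using h S(1) by (rule bij_betw_subset) simp
    ultimately have g: "bij_betw ?g {..<l} (?h ` S)"
      using bij_betw_trans[of "pick S" "{..<l}" S ?h] by (simp add: o_def)
    have sub: "?h ` S \<subseteq> ?J" using h S(1) by (auto simp: bij_betw_def)
    have "pick S i < ?n" if "i < l" for i
      using pick S(1) that by (auto simp: bij_betw_def)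
    then have "submatrix ?L S S = mat l l (\<lambda>(i, j). rs_c \<nu> \<gamma> (?x (?g i) - ?x (?g j)) *
        exp (- \<beta> * fold_theta \<theta> (?g j)) * rs_weight \<nu> \<gamma> ?J ?x {?g j})"
      unfolding submatrix_principal[OF L S(1)] S(2)
      by (intro cong_mat) (auto simp: C2_lax_def C2_lax_entry_def)
    then show ?thesis
      using rs_principal_minor[OF finite_indices sub g, of \<nu> ?x \<gamma> \<beta> "fold_theta \<theta>"] s c_finite sub
      by (simp add: subset_iff)
  qed
  have "bij_betw (image ?h) {S. S \<subseteq> {..<?n} \<and> card S = l} {I. I \<subseteq> ?J \<and> card I = l}"
    using h by (rule bij_betw_image_subsets_card)
  from sum.reindex_bij_betw[OF this, of ?F]
  have "C2_hamiltonian \<beta> \<nu> \<gamma> N q \<theta> l = (\<Sum>S | S \<subseteq> {..<?n} \<and> card S = l. ?F (?h ` S))"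
    by (simp only: C2_hamiltonian_eq[OF \<nu>])
  also have "\<dots> = sum_principal_minors l ?L"
    using L minor by (simp add: sum_principal_minors_def)
  finally show ?thesis .
qed

theorem mainTheorem4:
  fixes \<beta> \<nu> \<gamma> :: complex and N l :: nat and q \<theta> :: "nat \<Rightarrow> complex"
  assumes "\<beta> \<noteq> 0" "\<nu> \<noteq> 0" "\<gamma> \<noteq> 0"
    and "N \<ge> 1" "1 \<le> l" "l \<le> N + 1"
    and distinct_mod_T: "\<And>i k. i \<in> indices N \<Longrightarrow> k \<in> indices N \<Longrightarrow> i \<noteq> k \<Longrightarrow>
           \<not> (\<exists>n::int. fold_q \<nu> q i - fold_q \<nu> q k = of_int n * rs_period \<nu>)"
    and c_finite: "\<And>i k. i \<in> indices N \<Longrightarrow> k \<in> indices N \<Longrightarrow>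
           sinh (\<nu> * (fold_q \<nu> q i - fold_q \<nu> q k) / 2 + \<gamma>) \<noteq> 0"
  shows "C2_hamiltonian \<beta> \<nu> \<gamma> N q \<theta> l = sum_principal_minors l (C2_lax \<beta> \<nu> \<gamma> N q \<theta>)
       \<and> C2_hamiltonian \<beta> \<nu> \<gamma> N q \<theta> l =
           newton_poly l (\<lambda>m. mat_trace (C2_lax \<beta> \<nu> \<gamma> N q \<theta> ^\<^sub>m m))"
proof -
  let ?L = "C2_lax \<beta> \<nu> \<gamma> N q \<theta>"
  have "C2_hamiltonian \<beta> \<nu> \<gamma> N q \<theta> l = sum_principal_minors l ?L"
    by (rule C2_hamiltonian_sum_principal_minors[OF \<open>\<nu> \<noteq> 0\<close> distinct_mod_T c_finite])
  moreover have "?L \<in> carrier_mat (2 * N + 2) (2 * N + 2)"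
    by (simp add: C2_lax_def)
  ultimately show ?thesis
    by (simp add: sum_principal_minors_newton_poly)
qed

end
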